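(* Let $v\in\mathbb{R}^n$, $b\in\mathbb{R}^m$, $A\in\mathbb{R}^{m\times n}$ with $\operatorname{rank}A=m$ and no zero columns, and assume $P:=\{x\in\mathbb{R}^n_+ : Ax=b\}\neq\varnothing$. Consider the best approximation problem $$x^*(v):=\operatorname{argmin}_x\Big\{\tfrac12\|x-v\|^2 : Ax=b,\ x\in\mathbb{R}^n_+\Big\},\qquad p^*(v):=\tfrac12\|x^*(v)-v\|^2 .$$ Let $F(y):=A(v+A^Ty)_+-b$ and $f(y):=\tfrac12\|F(y)\|^2$ for $y\in\mathbb{R}^m$. Then the following hold. (i) The optimum $x^*(v)$ exists and is unique. Moreover, strong duality holds (zero duality gap and the dual value is attained), and the dual problem is the maximization of the dual functional $\phi(y,z)$: $$p^*(v)=d^*(v):=\max_{z\in\mathbb{R}^n_+,\ y\in\mathbb{R}^m}\phi(y,z),\qquad \phi(y,z):=-\tfrac12\|z+A^Ty\|^2+y^T(b-Av)-z^Tv .$$ (ii) Let $y\in\mathbb{R}^m$. Then $$F(y)=0\iff \Big(y\in\operatorname{argmin}_{u\in\mathbb{R}^m} f(u)\ \text{ and }\ x^*(v)=(v+A^Ty)_+\Big).$$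
   Context: $\|\cdot\|$ is the Euclidean norm, $\mathbb{R}^n_+$ is the nonnegative orthant, and for $x\in\mathbb{R}^n$, $x_+:=(\max\{0,x_i\})_{i=1}^n$ is the projection of $x$ onto $\mathbb{R}^n_+$. The dual problem is the Lagrangian dual with respect to $L(x,y,z)=\tfrac12\|x-v\|^2+y^T(b-Ax)-z^Tx$, with $y\in\mathbb{R}^m$, $z\in\mathbb{R}^n_+$. *)

theory Defs
  imports "HOL-Analysis.Analysis"
begin

definition nonneg_orthant :: "(real^'n) set" where
  "nonneg_orthant = {x. \<forall>i. 0 \<le> x $ i}"

definition pos_part :: "real^'n \<Rightarrow> real^'n" where
  "pos_part x = (\<chi> i. max 0 (x $ i))"

definition feasible :: "real^'n^'m \<Rightarrow> real^'m \<Rightarrow> (real^'n) set" where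
  "feasible A b = {x \<in> nonneg_orthant. A *v x = b}"

definition primal_obj :: "real^'n \<Rightarrow> real^'n \<Rightarrow> real" where
  "primal_obj v x = 1/2 * (norm (x - v))\<^sup>2"

(* arg_min_on is a choice operator: x_star is only meaningful once a unique
   minimizer is known to exist. *)
definition x_star :: "real^'n^'m \<Rightarrow> real^'m \<Rightarrow> real^'n \<Rightarrow> real^'n" where
  "x_star A b v = arg_min_on (primal_obj v) (feasible A b)"

definition p_star :: "real^'n^'m \<Rightarrow> real^'m \<Rightarrow> real^'n \<Rightarrow> real" where
  "p_star A b v = 1/2 * (norm (x_star A b v - v))\<^sup>2"

definition lagrangian ::
  "real^'n^'m \<Rightarrow> real^'m \<Rightarrow> real^'n \<Rightarrow> real^'n \<Rightarrow> real^'m \<Rightarrow> real^'n \<Rightarrow> real" where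
  "lagrangian A b v x y z =
     1/2 * (norm (x - v))\<^sup>2 + y \<bullet> (b - A *v x) - z \<bullet> x"

(* The infimum is taken in the extended reals, so that it has its intended
   meaning without a boundedness side condition. *)
definition lagrange_dual ::
  "real^'n^'m \<Rightarrow> real^'m \<Rightarrow> real^'n \<Rightarrow> real^'m \<Rightarrow> real^'n \<Rightarrow> ereal" where
  "lagrange_dual A b v y z = (INF x. ereal (lagrangian A b v x y z))"

definition phi ::
  "real^'n^'m \<Rightarrow> real^'m \<Rightarrow> real^'n \<Rightarrow> real^'m \<Rightarrow> real^'n \<Rightarrow> real" where
  "phi A b v y z =
     - 1/2 * (norm (z + transpose A *v y))\<^sup>2 + y \<bullet> (b - A *v v) - z \<bullet> v"

(* A supremum of reals: it is the maximum once a maximizer is known to exist. *)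
definition d_star :: "real^'n^'m \<Rightarrow> real^'m \<Rightarrow> real^'n \<Rightarrow> real" where
  "d_star A b v = (SUP (y, z) \<in> UNIV \<times> nonneg_orthant. phi A b v y z)"

definition F_res :: "real^'n^'m \<Rightarrow> real^'m \<Rightarrow> real^'n \<Rightarrow> real^'m \<Rightarrow> real^'m" where
  "F_res A b v y = A *v pos_part (v + transpose A *v y) - b"

definition f_res :: "real^'n^'m \<Rightarrow> real^'m \<Rightarrow> real^'n \<Rightarrow> real^'m \<Rightarrow> real" where
  "f_res A b v y = 1/2 * (norm (F_res A b v y))\<^sup>2"

end

theory Submission
  imports Defs
begin

text \<open>
  Completing the square gives
  \<open>L(x,y,z) = \<phi>(y,z) + 1/2 \<parallel>x - (v + A\<^sup>T y + z)\<parallel>\<^sup>2\<close>, so a feasible \<open>x = v + A\<^sup>T y + z\<close>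
  with \<open>z \<ge> 0\<close> and \<open>z \<bullet> x = 0\<close> is the unique primal optimum and \<open>(y,z)\<close> is dual optimal with
  zero gap. Such multipliers exist at the projection \<open>x\<close> of \<open>v\<close> onto the feasible set, without
  any Slater condition: \<open>x - v\<close> is nonnegative on the feasible directions, and the cone
  generated by the rows of \<open>\<plusminus>A\<close> and the unit vectors of the active bounds is closed because it
  is finitely generated, so separation puts \<open>x - v\<close> in that cone. If \<open>F y = 0\<close>, the
  multipliers are read off the decomposition of \<open>v + A\<^sup>T y\<close> into positive and negative part.
\<close>

section \<open>Adjoint identity and a Farkas lemma for finitely generated cones\<close>

lemma inner_transpose_matrix_vector:
  fixes A :: "real^'n^'m"
  shows "(transpose A *v y) \<bullet> x = y \<bullet> (A *v x)"
  by (simp add: dot_lmul_matrix)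

text \<open>A finitely generated cone is closed, so a point \<open>u\<close> outside it is strictly
  separated from it by some \<open>d\<close>. Scaling makes \<open>d\<close> nonnegative on
  \<open>S\<close>, while \<open>0\<close> in the cone makes \<open>d \<bullet> u\<close>
  negative.\<close>

lemma farkas_convex_cone_hull:
  fixes S :: "'a::euclidean_space set"
  assumes "finite S" and "\<And>d. (\<And>s. s \<in> S \<Longrightarrow> 0 \<le> d \<bullet> s) \<Longrightarrow> 0 \<le> d \<bullet> u"
  shows "u \<in> convex_cone hull S"
proof (rule ccontr)
  assume "u \<notin> convex_cone hull S"
  then obtain d \<beta> where d: "d \<bullet> u < \<beta>" "\<And>x. x \<in> convex_cone hull S \<Longrightarrow> \<beta> < d \<bullet> x"
    using separating_hyperplane_closed_point[of "convex_cone hull S" u]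
      convex_convex_cone_hull[of S] closed_convex_cone_hull[OF assms(1)]
    by (metis inner_commute)
  have "0 \<le> d \<bullet> s" if "s \<in> S" for s
  proof (rule ccontr)
    assume neg: "\<not> 0 \<le> d \<bullet> s"
    \<comment> \<open>Scaled so that \<open>d\<close> takes the value
      \<open>- \<bar>\<beta>\<bar>\<close> at \<open>t *\<^sub>R s\<close>, which cannot exceed
      \<beta>.\<close>
    define t where "t = \<bar>\<beta>\<bar> / - (d \<bullet> s)"
    have "t *\<^sub>R s \<in> convex_cone hull S"
      using that neg by (intro convex_cone_hull_mul hull_inc) (auto simp: t_def divide_le_0_iff)
    moreover have "d \<bullet> (t *\<^sub>R s) = - \<bar>\<beta>\<bar>"
      using neg by (simp add: t_def)
    ultimately show False
      using d(2)[of "t *\<^sub>R s"] by linarith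
  qed
  then have "0 \<le> d \<bullet> u"
    by (rule assms(2))
  then show False
    using d(1) d(2)[OF convex_cone_hull_contains_0] by simp
qed

section \<open>Geometry of the feasible polyhedron and its normal cone\<close>

lemma convex_feasible: "convex (feasible A b)"
proof (rule convexI)
  fix x y and s t :: real
  assume "x \<in> feasible A b" "y \<in> feasible A b" and st: "0 \<le> s" "0 \<le> t" "s + t = 1"
  moreover have "s *\<^sub>R b + t *\<^sub>R b = b"
    using st by (metis scaleR_left_distrib scaleR_one)
  ultimately show "s *\<^sub>R x + t *\<^sub>R y \<in> feasible A b"
    by (simp add: feasible_def nonneg_orthant_def matrix_vector_right_distrib
        matrix_vector_mult_scaleR)
qed

lemma closed_feasible:
  fixes A :: "real^'n^'m"
  shows "closed (feasible A b)"
proof -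
  have "feasible A b = (\<Inter>i. {x. 0 \<le> x $ i}) \<inter> {x. A *v x = b}"
    by (auto simp: feasible_def nonneg_orthant_def)
  moreover have "closed {x. A *v x = b}"
    by (intro closed_Collect_eq matrix_vector_mult_linear_continuous_on continuous_on_const)
  moreover have "closed (\<Inter>i. {x::real^'n. 0 \<le> x $ i})"
    by (intro closed_INT ballI closed_Collect_le continuous_on_const continuous_on_component
        continuous_on_id)
  ultimately show ?thesis
    by (simp only: closed_Int)
qed

text \<open>Bounds inactive at \<open>x\<close> survive small steps by continuity and active ones by
  the sign of \<open>d\<close>. As there are finitely many coordinates, one step length serves all
  of them.\<close>

lemma feasible_direction:
  assumes x: "x \<in> feasible A b" and Ad: "A *v d = 0"
    and d: "\<And>i. x $ i = 0 \<Longrightarrow> 0 \<le> d $ i"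
  obtains t where "0 < t" "x + t *\<^sub>R d \<in> feasible A b"
proof -
  have nonneg: "0 \<le> x $ i" for i
    using x by (simp add: feasible_def nonneg_orthant_def)
  have "\<forall>\<^sub>F t in at_right 0. 0 \<le> x $ i + t * d $ i" for i
  proof (cases "x $ i = 0")
    case True
    then show ?thesis
      using d[OF True] by (intro eventually_mono[OF eventually_at_right_less[of 0]]) simp
  next
    case False
    have "((\<lambda>t. x $ i + t * d $ i) \<longlongrightarrow> x $ i + 0 * d $ i) (at_right 0)"
      by (intro tendsto_intros)
    moreover have "0 < x $ i + 0 * d $ i"
      using False nonneg[of i] by simp
    ultimately have "\<forall>\<^sub>F t in at_right 0. 0 < x $ i + t * d $ i"
      by (rule order_tendstoD)
    then show ?thesis
      by eventually_elim simp
  qed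
  then have "\<forall>\<^sub>F t in at_right 0. \<forall>i. 0 \<le> x $ i + t * d $ i"
    by (rule eventually_all_finite)
  then have "\<forall>\<^sub>F t in at_right 0. 0 < t \<and> (\<forall>i. 0 \<le> x $ i + t * d $ i)"
    by (rule eventually_conj[OF eventually_at_right_less])
  then obtain t :: real where "0 < t" "\<forall>i. 0 \<le> x $ i + t * d $ i"
    by (auto dest: eventually_happens'[OF trivial_limit_at_right_real])
  then show ?thesis
    using x Ad by (intro that[of t])
      (auto simp: feasible_def nonneg_orthant_def matrix_vector_right_distrib
        matrix_vector_mult_scaleR)
qed

text \<open>The vector \<open>- u\<close> is normal to the polyhedron at \<open>x\<close>. Farkas
  applies because every \<open>d\<close> nonnegative on the generators is a feasible
  direction.\<close>

lemma normal_cone_feasible: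
  fixes A :: "real^'n^'m"
  assumes x: "x \<in> feasible A b" and u: "\<And>x'. x' \<in> feasible A b \<Longrightarrow> 0 \<le> u \<bullet> (x' - x)"
  obtains y z where "z \<in> nonneg_orthant" "z \<bullet> x = 0" "u = transpose A *v y + z"
proof -
  \<comment> \<open>These are the rows of \<open>A\<close>. Taking them with both signs leaves
    \<open>y\<close> free in sign; the unit vectors of the active bounds yield \<open>z\<close>,
    whence complementarity.\<close>
  let ?R = "range (\<lambda>j. transpose A *v axis j 1)"
  let ?S = "?R \<union> uminus ` ?R \<union> (\<lambda>i. axis i 1) ` {i. x $ i = 0}"
  let ?C = "{transpose A *v y + z |y z. z \<in> nonneg_orthant \<and> z \<bullet> x = 0}"
  have "u \<in> convex_cone hull ?S"
  proof (rule farkas_convex_cone_hull)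
    fix d assume d: "\<And>s. s \<in> ?S \<Longrightarrow> 0 \<le> d \<bullet> s"
    have "(A *v d) $ j = 0" for j
    proof -
      have "0 \<le> d \<bullet> (transpose A *v axis j 1)" "0 \<le> d \<bullet> (- (transpose A *v axis j 1))"
        by (rule d; blast)+
      then have "(transpose A *v axis j 1) \<bullet> d = 0"
        by (simp add: inner_commute)
      then show ?thesis
        by (simp only: inner_transpose_matrix_vector inner_axis') simp
    qed
    then have Ad: "A *v d = 0"
      by (simp add: vec_eq_iff)
    have "0 \<le> d $ i" if "x $ i = 0" for i
      using d[of "axis i 1"] that by (auto simp: inner_axis)
    then obtain t where "0 < t" "x + t *\<^sub>R d \<in> feasible A b"
      using feasible_direction[OF x Ad] by blast
    with u[of "x + t *\<^sub>R d"] show "0 \<le> d \<bullet> u"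
      by (simp add: zero_le_mult_iff inner_commute)
  qed simp
  \<comment> \<open>The target set \<open>?C\<close> is itself a convex cone containing the
    generators.\<close>
  moreover have "convex_cone hull ?S \<subseteq> ?C"
  proof (rule hull_minimal)
    have rows: "transpose A *v y \<in> ?C" for y
      by (intro CollectI exI[of _ y] exI[of _ 0]) (simp add: nonneg_orthant_def)
    have neg_rows: "- (transpose A *v y) \<in> ?C" for y
      using rows[of "- y"] by (simp only: linear_neg[OF matrix_vector_mul_linear])
    have units: "axis i 1 \<in> ?C" if "x $ i = 0" for i
    proof (intro CollectI exI[of _ "0::real^'m"] exI[of _ "axis i 1"] conjI)
      show "axis i 1 \<in> (nonneg_orthant :: (real^'n) set)"
        by (simp add: nonneg_orthant_def axis_def)
    qed (use that in \<open>simp_all add: inner_axis'\<close>)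
    show "?S \<subseteq> ?C"
      using rows neg_rows units by (intro Un_least image_subsetI) (blast+)
    have "p + q \<in> ?C" if "p \<in> ?C" "q \<in> ?C" for p q
    proof -
      from that obtain y z y' z' where
        "p = transpose A *v y + z" "z \<in> nonneg_orthant" "z \<bullet> x = 0"
        "q = transpose A *v y' + z'" "z' \<in> nonneg_orthant" "z' \<bullet> x = 0" by blast
      then show ?thesis
        by (intro CollectI exI[of _ "y + y'"] exI[of _ "z + z'"])
          (simp add: nonneg_orthant_def inner_left_distrib matrix_vector_right_distrib
            del: transpose_matrix_vector)
    qed
    moreover have "c *\<^sub>R p \<in> ?C" if "p \<in> ?C" "0 \<le> c" for p c
    proof -
      from that obtain y z where
        "p = transpose A *v y + z" "z \<in> nonneg_orthant" "z \<bullet> x = 0" by blast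
      then show ?thesis
        using that by (intro CollectI exI[of _ "c *\<^sub>R y"] exI[of _ "c *\<^sub>R z"])
          (simp add: nonneg_orthant_def scaleR_right_distrib matrix_vector_mult_scaleR
            del: transpose_matrix_vector)
    qed
    moreover have "0 \<in> ?C"
      by (intro CollectI exI[of _ 0]) (simp add: nonneg_orthant_def)
    ultimately show "convex_cone ?C"
      unfolding convex_cone_iff by blast
  qed
  ultimately show ?thesis
    using that by blast
qed

section \<open>The dual functional and weak duality\<close>

lemma lagrangian_eq_phi:
  fixes A :: "real^'n^'m"
  shows "lagrangian A b v x y z =
    phi A b v y z + 1/2 * (norm (x - (v + transpose A *v y + z)))\<^sup>2"
proof -
  define w where "w = transpose A *v y"
  have "y \<bullet> (A *v x) = w \<bullet> x" "y \<bullet> (A *v v) = w \<bullet> v"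
    unfolding w_def inner_transpose_matrix_vector by simp_all
  then show ?thesis
    unfolding lagrangian_def phi_def w_def[symmetric] power2_norm_eq_inner
    by (simp add: inner_diff_left inner_diff_right inner_left_distrib inner_right_distrib
        inner_commute field_simps)
qed

text \<open>The square in \<open>lagrangian_eq_phi\<close> vanishes at
  \<open>x = v + transpose A *v y + z\<close>, so the infimum is attained there.\<close>

lemma lagrange_dual_eq_phi: "lagrange_dual A b v y z = ereal (phi A b v y z)"
  unfolding lagrange_dual_def
proof (rule antisym)
  have "(INF x. ereal (lagrangian A b v x y z))
      \<le> ereal (lagrangian A b v (v + transpose A *v y + z) y z)"
    by (rule INF_lower) simp
  then show "(INF x. ereal (lagrangian A b v x y z)) \<le> ereal (phi A b v y z)"
    by (simp add: lagrangian_eq_phi)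
qed (auto intro!: INF_greatest simp: lagrangian_eq_phi)

lemma lagrangian_feasible:
  "x \<in> feasible A b \<Longrightarrow> lagrangian A b v x y z = primal_obj v x - z \<bullet> x"
  by (simp add: lagrangian_def primal_obj_def feasible_def)

lemma inner_nonneg_orthant:
  "x \<in> nonneg_orthant \<Longrightarrow> z \<in> nonneg_orthant \<Longrightarrow> 0 \<le> z \<bullet> x"
  by (auto simp: nonneg_orthant_def inner_vec_def intro!: sum_nonneg)

text \<open>Weak duality with the square kept: it later yields uniqueness of the primal
  optimum.\<close>

lemma weak_duality_gap:
  assumes "x \<in> feasible A b" "z \<in> nonneg_orthant"
  shows "phi A b v y z + 1/2 * (norm (x - (v + transpose A *v y + z)))\<^sup>2 \<le> primal_obj v x"
proof -
  have "0 \<le> z \<bullet> x"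
    using assms by (simp add: feasible_def inner_nonneg_orthant)
  then show ?thesis
    using lagrangian_eq_phi[of A b v x y z] lagrangian_feasible[OF assms(1), of v y z] by simp
qed

text \<open>The last equation is stationarity of the Lagrangian in \<open>x\<close>. A KKT triple
  certifies primal and dual optimality at once.\<close>

definition kkt :: "real^'n^'m \<Rightarrow> real^'m \<Rightarrow> real^'n \<Rightarrow> real^'n \<Rightarrow> real^'m \<Rightarrow> real^'n \<Rightarrow> bool" where
  "kkt A b v x y z \<longleftrightarrow> x \<in> feasible A b \<and> z \<in> nonneg_orthant \<and> z \<bullet> x = 0 \<and>
     v + transpose A *v y + z = x"

lemma kkt_zero_gap: "kkt A b v x y z \<Longrightarrow> phi A b v y z = primal_obj v x"
  using lagrangian_eq_phi[of A b v x y z] lagrangian_feasible[of x A b v y z]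
  by (simp add: kkt_def)

lemma kkt_imp_is_arg_min_iff:
  assumes "kkt A b v x y z"
  shows "is_arg_min (primal_obj v) (\<lambda>x. x \<in> feasible A b) x' \<longleftrightarrow> x' = x"
proof -
  \<comment> \<open>Stationarity turns the square in \<open>weak_duality_gap\<close> into the
    squared distance to \<open>x\<close>: quadratic growth around the optimum.\<close>
  have gap: "primal_obj v x + 1/2 * (norm (x' - x))\<^sup>2 \<le> primal_obj v x'"
    if "x' \<in> feasible A b" for x'
    using weak_duality_gap[OF that, of z v y] assms kkt_zero_gap[OF assms] by (simp add: kkt_def)
  have "x \<in> feasible A b"
    using assms by (simp add: kkt_def)
  moreover have "primal_obj v x \<le> primal_obj v x'" if "x' \<in> feasible A b" for x'
    using gap[OF that] zero_le_power2[of "norm (x' - x)"] by linarith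
  moreover have "x' = x" if "x' \<in> feasible A b" "primal_obj v x' \<le> primal_obj v x"
  proof -
    have "(norm (x' - x))\<^sup>2 \<le> 0"
      using gap[OF that(1)] that(2) by linarith
    then show ?thesis by simp
  qed
  ultimately show ?thesis
    unfolding is_arg_min_linorder by blast
qed

text \<open>Uniqueness leaves the choice operator in \<open>x_star\<close> only one
  candidate.\<close>

lemma kkt_imp_x_star:
  assumes "kkt A b v x y z"
  shows "x_star A b v = x"
  unfolding x_star_def arg_min_on_def arg_min_def kkt_imp_is_arg_min_iff[OF assms] by simp

lemma kkt_imp_dual_maximizer:
  assumes "kkt A b v x y z"
  shows "is_arg_max (\<lambda>(y, z). phi A b v y z) (\<lambda>yz. yz \<in> UNIV \<times> nonneg_orthant) (y, z)"
proof -
  have "phi A b v y' z' \<le> phi A b v y z" if "z' \<in> nonneg_orthant" for y' z'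
  proof -
    have "x \<in> feasible A b"
      using assms by (simp add: kkt_def)
    from weak_duality_gap[OF this that, of v y'] show ?thesis
      using zero_le_power2[of "norm (x - (v + transpose A *v y' + z'))"]
      unfolding kkt_zero_gap[OF assms] by linarith
  qed
  then show ?thesis
    using assms by (auto simp: is_arg_max_linorder kkt_def)
qed

text \<open>The value at \<open>(y, z)\<close> is attained and bounds all others, so the real
  supremum is a maximum.\<close>

lemma kkt_imp_d_star:
  assumes "kkt A b v x y z"
  shows "d_star A b v = primal_obj v x"
  unfolding d_star_def
proof (rule cSup_eq_maximum)
  show "primal_obj v x \<in> (\<lambda>(y, z). phi A b v y z) ` (UNIV \<times> nonneg_orthant)"
    using assms by (intro image_eqI[of _ _ "(y, z)"]) (simp_all add: kkt_zero_gap[OF assms], simp add: kkt_def)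
  show "p \<le> primal_obj v x" if "p \<in> (\<lambda>(y, z). phi A b v y z) ` (UNIV \<times> nonneg_orthant)" for p
    using that kkt_imp_dual_maximizer[OF assms]
    by (auto simp: is_arg_max_linorder simp flip: kkt_zero_gap[OF assms])
qed

lemma kkt_exists:
  assumes "feasible A b \<noteq> {}"
  obtains x y z where "kkt A b v x y z"
proof -
  define x where "x = closest_point (feasible A b) v"
  have x: "x \<in> feasible A b"
    unfolding x_def using closed_feasible assms by (rule closest_point_in_set)
  \<comment> \<open>Variational inequality of the projection onto a closed convex set.\<close>
  have "0 \<le> (x - v) \<bullet> (x' - x)" if "x' \<in> feasible A b" for x'
    using closest_point_dot[OF convex_feasible closed_feasible that, of v]
    unfolding x_def[symmetric] by (simp add: inner_diff_left)
  then obtain y z where "z \<in> nonneg_orthant" "z \<bullet> x = 0" "x - v = transpose A *v y + z"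
    using normal_cone_feasible[OF x] by blast
  then have "kkt A b v x y z"
    using x by (simp add: kkt_def algebra_simps)
  then show ?thesis
    by (rule that)
qed

lemma pos_part_feasible_iff: "pos_part (v + transpose A *v y) \<in> feasible A b \<longleftrightarrow> F_res A b v y = 0"
  by (simp add: feasible_def F_res_def nonneg_orthant_def pos_part_def)

text \<open>Moreau decomposition of \<open>w = v + transpose A *v y\<close>: the negative part
  serves as \<open>z\<close> and is orthogonal to the positive part, which is feasible by the
  assumption.\<close>

lemma kkt_pos_part:
  assumes "F_res A b v y = 0"
  shows "kkt A b v (pos_part (v + transpose A *v y)) y (pos_part (- (v + transpose A *v y)))"
proof -
  define w where "w = v + transpose A *v y"
  have "pos_part w = w + pos_part (- w)" "pos_part (- w) \<bullet> pos_part w = 0"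
    "pos_part (- w) \<in> nonneg_orthant"
    by (auto simp: pos_part_def vec_eq_iff inner_vec_def nonneg_orthant_def max_def
        intro!: sum.neutral)
  then show ?thesis
    using assms unfolding kkt_def pos_part_feasible_iff[symmetric] w_def[symmetric] by simp
qed

theorem theorem2p1:
  fixes v :: "real^'n" and b :: "real^'m" and A :: "real^'n^'m"
  assumes rank_A: "rank A = CARD('m)"
    and no_zero_columns: "\<forall>j. column j A \<noteq> 0"
    and feasible_nonempty: "feasible A b \<noteq> {}"
  shows "((\<exists>!x. is_arg_min (primal_obj v) (\<lambda>x. x \<in> feasible A b) x) \<and>
          (\<forall>y. \<forall>z \<in> nonneg_orthant. lagrange_dual A b v y z = ereal (phi A b v y z)) \<and>
          (\<exists>yz. is_arg_max (\<lambda>(y, z). phi A b v y z) (\<lambda>yz. yz \<in> UNIV \<times> nonneg_orthant) yz) \<and>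
          p_star A b v = d_star A b v) \<and>
         (\<forall>y. F_res A b v y = 0 \<longleftrightarrow>
            is_arg_min (f_res A b v) (\<lambda>u. u \<in> UNIV) y \<and>
            x_star A b v = pos_part (v + transpose A *v y))"
proof (intro conjI allI ballI)
  obtain x y z where kkt: "kkt A b v x y z"
    using kkt_exists[OF feasible_nonempty] .
  show "\<exists>!x. is_arg_min (primal_obj v) (\<lambda>x. x \<in> feasible A b) x"
    using kkt_imp_is_arg_min_iff[OF kkt] by simp
  show "\<exists>yz. is_arg_max (\<lambda>(y, z). phi A b v y z) (\<lambda>yz. yz \<in> UNIV \<times> nonneg_orthant) yz"
    using kkt_imp_dual_maximizer[OF kkt] by blast
  show "p_star A b v = d_star A b v"
    unfolding p_star_def kkt_imp_x_star[OF kkt] kkt_imp_d_star[OF kkt] primal_obj_def ..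
  show "lagrange_dual A b v y z = ereal (phi A b v y z)" for y z
    by (rule lagrange_dual_eq_phi)
  show "F_res A b v y = 0 \<longleftrightarrow> is_arg_min (f_res A b v) (\<lambda>u. u \<in> UNIV) y \<and>
    x_star A b v = pos_part (v + transpose A *v y)" for y
  proof (intro iffI conjI)
    assume F: "F_res A b v y = 0"
    then show "is_arg_min (f_res A b v) (\<lambda>u. u \<in> UNIV) y"
      by (simp add: is_arg_min_linorder f_res_def)
    show "x_star A b v = pos_part (v + transpose A *v y)"
      using kkt_pos_part[OF F] by (rule kkt_imp_x_star)
  next
    assume "is_arg_min (f_res A b v) (\<lambda>u. u \<in> UNIV) y \<and>
      x_star A b v = pos_part (v + transpose A *v y)"
    \<comment> \<open>The positive part is thereby the optimum \<open>x\<close>, and feasibility of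
      \<open>x\<close> amounts to a zero residual.\<close>
    then have "pos_part (v + transpose A *v y) = x"
      using kkt_imp_x_star[OF kkt] by simp
    then show "F_res A b v y = 0"
      using kkt by (simp add: kkt_def flip: pos_part_feasible_iff)
  qed
qed

end
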